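(* When the label setting algorithm described in the context stops, the permanent labels at $t$ represent a complete set of efficient solutions of the deterministic multi-objective shortest path problem $$\min_{q\in Q} z^L(q)=\Big(\sum_{e\in q}\hat c_e,\ \max_{e\in q}\delta_e,\ 2\text{-}\max_{e\in q}\delta_e,\ \dots,\ \Gamma\text{-}\max_{e\in q}\delta_e\Big).$$
   Context: $G=(V,E)$ is a finite directed graph without parallel edges, $s,t\in V$, and $Q$ is the set of simple paths from $s$ to $t$ (identified with their edge sets). Each edge $e$ has a nominal cost $\hat c_e\ge0$ and an interval length $\delta_e\ge0$; $\Gamma$ is an integer with $0\le\Gamma\le|E|$. $j\text{-}\max_{e\in q}\delta_e$ is the $j$-th largest of the values $\delta_e$, $e\in q$, counted with multiplicity, and $0$ if $q$ has fewer than $j$ edges. A vector $y^1$ dominates $y^2$ if $y^1_i\le y^2_i$ for all $i$ and $y^1\ne y^2$. A path $q\in Q$ is efficient if no $q'\in Q$ has $z^L(q')$ dominating $z^L(q)$; two efficient $q,q'$ are equivalent if $z^L(q)=z^L(q')$; a set $\bar Q\subseteq Q$ of efficient solutions is complete if every $q\in Q\setminus\bar Q$ is dominated by or equivalent to some element of $\bar Q$. Label setting algorithm. A label at a node $v$ is a triple $(z,v',l')$ with cost vector $z=(z_0,\dots,z_\Gamma)$, predecessor node $v'$ and predecessor label $l'$ (a label at $v'$); it is temporary or permanent. A label represents the path from $s$ to $v$ obtained by backtracking predecessor labels. For $z'\in\mathbb R^{\Gamma+1}$ and $a,d\ge 0$ define $z=z'\oplus(a,d)$ by $z_0=z'_0+a$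 and: if $d\le z'_i$ for all $i=1,\dots,\Gamma$, then $z_i=z'_i$ for all $i\ge1$; otherwise, with $i\ge1$ minimal such that $d>z'_i$, $z_j=z'_j$ for $1\le j<i$, $z_i=d$, $z_j=z'_{j-1}$ for $i<j\le\Gamma$. Start: create a temporary label with cost $(0,\dots,0)$ at $s$. While a temporary label exists: select a temporary label $l'$ (at any node $v'$, with cost $z'$) with minimal aggregate cost $\sum_{i=0}^\Gamma z'_i$ among all temporary labels and make it permanent; then for every outgoing edge $(v',v)$ of $v'$ create a temporary label $l$ at $v$ with cost $z'\oplus(\hat c_{(v',v)},\delta_{(v',v)})$, predecessor node $v'$ and predecessor label $l'$; if the cost of $l$ is dominated by or equal to the cost of another label at $v$, delete $l$; otherwise delete all temporary labels at $v$ dominated by $l$. *)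

theory Defs
  imports Complex_Main "HOL-Library.Multiset" "Graph_Theory.Pair_Digraph"
begin

section \<open>Efficient solutions of multi-objective minimization problems\<close>

text \<open>Cost vectors with entries \<open>z\<^sub>0, \<dots>, z\<^sub>\<Gamma>\<close> are lists of length \<open>\<Gamma> + 1\<close>, with \<open>z\<^sub>i = z ! i\<close>.\<close>

type_synonym cost_vec = "real list"

definition dominates :: "cost_vec \<Rightarrow> cost_vec \<Rightarrow> bool" where
  "dominates x y \<longleftrightarrow> list_all2 (\<le>) x y \<and> x \<noteq> y"

definition efficient :: "('q \<Rightarrow> cost_vec) \<Rightarrow> 'q set \<Rightarrow> 'q \<Rightarrow> bool" where
  "efficient z Q q \<longleftrightarrow> q \<in> Q \<and> (\<forall>q'\<in>Q. \<not> dominates (z q') (z q))"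

definition equivalent_solutions :: "('q \<Rightarrow> cost_vec) \<Rightarrow> 'q set \<Rightarrow> 'q \<Rightarrow> 'q \<Rightarrow> bool" where
  "equivalent_solutions z Q q q' \<longleftrightarrow> efficient z Q q \<and> efficient z Q q' \<and> z q = z q'"

definition complete_efficient_set :: "('q \<Rightarrow> cost_vec) \<Rightarrow> 'q set \<Rightarrow> 'q set \<Rightarrow> bool" where
  "complete_efficient_set z Q R \<longleftrightarrow>
     R \<subseteq> Q \<and> (\<forall>q\<in>R. efficient z Q q) \<and>
     (\<forall>q\<in>Q - R. \<exists>r\<in>R. dominates (z r) (z q) \<or> equivalent_solutions z Q r q)"

section \<open>The shortest path problem\<close>

definition st_paths :: "'a pair_pre_digraph \<Rightarrow> 'a \<Rightarrow> 'a \<Rightarrow> ('a \<times> 'a) set set" where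
  "st_paths G s t = {set p | p. pre_digraph.apath (with_proj G) s p t}"

definition j_max :: "nat \<Rightarrow> ('e \<Rightarrow> real) \<Rightarrow> 'e set \<Rightarrow> real" where
  "j_max j \<delta> q =
     (let xs = rev (sorted_list_of_multiset (image_mset \<delta> (mset_set q)))
      in if j \<le> length xs then xs ! (j - 1) else 0)"

definition zL :: "('e \<Rightarrow> real) \<Rightarrow> ('e \<Rightarrow> real) \<Rightarrow> nat \<Rightarrow> 'e set \<Rightarrow> cost_vec" where
  "zL c \<delta> \<Gamma> q = (\<Sum>e\<in>q. c e) # map (\<lambda>j. j_max j \<delta> q) [1..<Suc \<Gamma>]"

section \<open>The label setting algorithm\<close>

text \<open>The operation \<open>z \<oplus> (a, d)\<close>.\<close>

definition extend_cost :: "nat \<Rightarrow> cost_vec \<Rightarrow> real \<Rightarrow> real \<Rightarrow> cost_vec" where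
  "extend_cost \<Gamma> z a d =
     (z ! 0 + a) #
     (if \<forall>i\<in>{1..\<Gamma>}. d \<le> z ! i then map (\<lambda>j. z ! j) [1..<Suc \<Gamma>]
      else let i = (LEAST i. i \<in> {1..\<Gamma>} \<and> z ! i < d)
           in map (\<lambda>j. if j < i then z ! j else if j = i then d else z ! (j - 1)) [1..<Suc \<Gamma>])"

text \<open>A label carries the node at which it is placed. \<open>Label v z v' l'\<close> is the label
  \<open>(z, v', l')\<close> at \<open>v\<close>; the label created at the start has no predecessor. The predecessor
  label is stored as a value rather than as a reference.\<close>

datatype 'a label =
    Start_Label (label_node: 'a) (label_cost: cost_vec)
  | Label (label_node: 'a) (label_cost: cost_vec) 'a "'a label"

primrec label_path :: "'a label \<Rightarrow> ('a \<times> 'a) list" where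
  "label_path (Start_Label v z) = []"
| "label_path (Label v z v' l') = label_path l' @ [(v', v)]"

text \<open>Treatment of one outgoing edge \<open>e\<close> of the node of the label \<open>l'\<close>. The sets \<open>P\<close> and \<open>T\<close>
  contain the permanent (including \<open>l'\<close>) and the temporary labels; the new \<open>T\<close> is returned.\<close>

definition process_edge ::
  "('a \<times> 'a \<Rightarrow> real) \<Rightarrow> ('a \<times> 'a \<Rightarrow> real) \<Rightarrow> nat \<Rightarrow> 'a label \<Rightarrow> 'a label set
    \<Rightarrow> 'a \<times> 'a \<Rightarrow> 'a label set \<Rightarrow> 'a label set" where
  "process_edge c \<delta> \<Gamma> l' P e T =
     (let v = snd e;
          l = Label v (extend_cost \<Gamma> (label_cost l') (c e) (\<delta> e)) (fst e) l'
      in if \<exists>m\<in>T \<union> P. label_node m = v \<and>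
              (dominates (label_cost m) (label_cost l) \<or> label_cost m = label_cost l)
         then T
         else insert l {m\<in>T. \<not> (label_node m = v \<and> dominates (label_cost l) (label_cost m))})"

text \<open>One iteration on states \<open>(T, P)\<close>. The choice among the temporary labels of minimal
  aggregate cost and the order \<open>es\<close> of the outgoing edges are arbitrary.\<close>

inductive label_step ::
  "'a pair_pre_digraph \<Rightarrow> ('a \<times> 'a \<Rightarrow> real) \<Rightarrow> ('a \<times> 'a \<Rightarrow> real) \<Rightarrow> nat
    \<Rightarrow> 'a label set \<times> 'a label set \<Rightarrow> 'a label set \<times> 'a label set \<Rightarrow> bool"
  for G c \<delta> \<Gamma> where
  "\<lbrakk> l' \<in> T;
     \<forall>m\<in>T. sum_list (label_cost l') \<le> sum_list (label_cost m);
     distinct es;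
     set es = out_arcs (with_proj G) (label_node l') \<rbrakk>
   \<Longrightarrow> label_step G c \<delta> \<Gamma> (T, P)
         (fold (process_edge c \<delta> \<Gamma> l' (insert l' P)) es (T - {l'}), insert l' P)"

definition initial_state :: "nat \<Rightarrow> 'a \<Rightarrow> 'a label set \<times> 'a label set" where
  "initial_state \<Gamma> s = ({Start_Label s (replicate (Suc \<Gamma>) 0)}, {})"

text \<open>The algorithm can stop with the set \<open>P\<close> of permanent labels.\<close>

definition stops_with ::
  "'a pair_pre_digraph \<Rightarrow> ('a \<times> 'a \<Rightarrow> real) \<Rightarrow> ('a \<times> 'a \<Rightarrow> real) \<Rightarrow> nat \<Rightarrow> 'a
    \<Rightarrow> 'a label set \<Rightarrow> bool" where
  "stops_with G c \<delta> \<Gamma> s P \<longleftrightarrow> (label_step G c \<delta> \<Gamma>)\<^sup>*\<^sup>* (initial_state \<Gamma> s) ({}, P)"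

definition represented_paths :: "'a label set \<Rightarrow> 'a \<Rightarrow> ('a \<times> 'a) set set" where
  "represented_paths P v = {set (label_path l) | l. l \<in> P \<and> label_node l = v}"

end

theory Submission
  imports Defs
begin

text \<open>
  The proof has an order-theoretic and an algorithmic half.

  On cost vectors whose entries \<open>1, \<dots>, \<Gamma>\<close> decrease, \<open>z \<oplus> (a, d)\<close> has the closed form
  \<open>max z\<^sub>j (min d z\<^sub>j\<^sub>-\<^sub>1)\<close> in each such entry \<open>j\<close>, with \<open>z\<^sub>j\<^sub>-\<^sub>1\<close> read as \<open>\<infinity>\<close> for \<open>j = 1\<close>
  (\<open>extend_cost_nth\<close>).  This expression is monotone in \<open>z\<close> and never falls below \<open>z\<close>, and it
  is also the recursion satisfied by the \<open>j\<close>-th largest interval length when an edge is added to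
  a set (\<open>j_max_insert\<close>).  So \<open>\<oplus>\<close> computes \<open>zL\<close> along simple paths, an extended path
  costs at least as much as the path itself, and Bellman's principle holds in the form that
  extending a componentwise smaller vector by the same edge gives a componentwise smaller vector.

  For the algorithm, call a vector at a node covered if some label there is componentwise no
  larger.  Labels are only rejected or deleted in favour of labels that are no worse, so a
  vector that is covered stays covered, and every extension of a permanent label is covered.
  When no temporary label is left, Bellman's principle and induction along a path show that the
  permanent labels cover all simple paths (\<open>permanent_labels_cover_paths\<close>).

  Conversely a permanent label is never dominated by another label.  Permanent labels are chosen
  by minimal aggregate cost and extensions do not lower the aggregate cost, so every label
  created later has at least the aggregate cost of each permanent label, whereas domination
  strictly lowers it (\<open>inv_process_edge\<close>).  Moreover all labels represent simple paths: closing
  a cycle leads back to a node where an ancestor of the label, which is permanent, is no worse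
  (\<open>ancestors_cover_path\<close>, \<open>sound_extension\<close>).  Covering together with the absence of
  domination among permanent labels is completeness.
\<close>

section \<open>Componentwise comparison\<close>

abbreviation le_vec :: "cost_vec \<Rightarrow> cost_vec \<Rightarrow> bool" (infix "\<preceq>" 50) where
  "x \<preceq> y \<equiv> list_all2 (\<le>) x y"

lemma le_vec_refl: "x \<preceq> x"
  by (simp add: list_all2_refl)

lemma le_vec_trans: "x \<preceq> y \<Longrightarrow> y \<preceq> z \<Longrightarrow> x \<preceq> z"
  by (rule list_all2_trans[of "(\<le>)" "(\<le>)" "(\<le>)"]) auto

lemma le_vec_antisym: "x \<preceq> y \<Longrightarrow> y \<preceq> x \<Longrightarrow> x = y"
  by (rule list_all2_antisym[of "(\<le>)" "(\<le>)"]) auto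

lemma dominates_or_eq_iff: "dominates x y \<or> x = y \<longleftrightarrow> x \<preceq> y"
  using le_vec_refl by (auto simp: dominates_def)

lemma dominates_le_trans: "x \<preceq> y \<Longrightarrow> dominates y z \<Longrightarrow> dominates x z"
  unfolding dominates_def using le_vec_trans le_vec_antisym by blast

lemma sum_list_le_vec: "x \<preceq> y \<Longrightarrow> sum_list x \<le> sum_list y"
  by (induction rule: list_all2_induct) auto

lemma sum_list_less_if_dominates:
  assumes "dominates x y"
  shows "sum_list x < sum_list y"
proof -
  have "x \<noteq> y \<Longrightarrow> sum_list x < sum_list y" if "x \<preceq> y"
    using that
  proof (induction rule: list_all2_induct)
    case (Cons x xs y ys)
    then show ?case
      using sum_list_le_vec[of xs ys] by (cases "x = y") auto
  qed simp
  then show ?thesis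
    using assms by (simp add: dominates_def)
qed

section \<open>Extension of cost vectors\<close>

definition ranked :: "nat \<Rightarrow> cost_vec \<Rightarrow> bool" where
  "ranked \<Gamma> z \<longleftrightarrow> length z = Suc \<Gamma> \<and> (\<forall>i j. 1 \<le> i \<longrightarrow> i \<le> j \<longrightarrow> j \<le> \<Gamma> \<longrightarrow> z ! j \<le> z ! i)"

lemma length_extend_cost: "length (extend_cost \<Gamma> z a d) = Suc \<Gamma>"
  by (simp add: extend_cost_def Let_def)

lemma extend_cost_nth_0: "extend_cost \<Gamma> z a d ! 0 = z ! 0 + a"
  by (simp add: extend_cost_def)

text \<open>The least \<open>i\<close> with \<open>z\<^sub>i < d\<close> separates the entries: before it the maximum is \<open>z\<^sub>j\<close>,
  at it the maximum is \<open>d\<close>, and after it the value is \<open>z\<^sub>j\<^sub>-\<^sub>1\<close> because \<open>z\<close> decreases.  Without such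
  an \<open>i\<close> every entry is at least \<open>d\<close>, and the maximum is \<open>z\<^sub>j\<close> throughout.  In this form the
  monotonicity of \<open>\<oplus>\<close>, which the case distinction of its definition hides, is evident.\<close>

lemma extend_cost_nth:
  assumes z: "ranked \<Gamma> z" and j: "1 \<le> j" "j \<le> \<Gamma>"
  shows "extend_cost \<Gamma> z a d ! j = max (z ! j) (if j = 1 then d else min d (z ! (j - 1)))"
proof (cases "\<forall>i\<in>{1..\<Gamma>}. d \<le> z ! i")
  case True
  then have "extend_cost \<Gamma> z a d ! j = z ! j"
    using j by (simp add: extend_cost_def nth_Cons' del: upt_Suc)
  moreover have "d \<le> z ! j"
    using True j by auto
  ultimately show ?thesis
    by (auto simp: max_def min_def)
next
  case False
  define i where "i = (LEAST i. i \<in> {1..\<Gamma>} \<and> z ! i < d)"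
  have ex: "\<exists>i. i \<in> {1..\<Gamma>} \<and> z ! i < d"
    using False by force
  have i: "i \<in> {1..\<Gamma>}" "z ! i < d"
    using LeastI_ex[OF ex] by (simp_all add: i_def)
  have before: "d \<le> z ! k" if "1 \<le> k" "k < i" for k
    using not_less_Least[of k "\<lambda>i. i \<in> {1..\<Gamma>} \<and> z ! i < d", folded i_def] that i by auto
  have decr: "z ! l \<le> z ! k" if "1 \<le> k" "k \<le> l" "l \<le> \<Gamma>" for k l
    using z that by (auto simp: ranked_def)
  have ext: "extend_cost \<Gamma> z a d ! j = (if j < i then z ! j else if j = i then d else z ! (j - 1))"
    unfolding extend_cost_def Let_def if_not_P[OF False] i_def[symmetric]
    using j by (simp add: nth_Cons' del: upt_Suc)
  consider "j < i" | "j = i" | "i < j"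
    by linarith
  then show ?thesis
  proof cases
    case 1
    then show ?thesis
      using ext before[of j] j by (auto simp: max_def min_def)
  next
    case 2
    then show ?thesis
      using ext before[of "j - 1"] j i by (auto simp: max_def min_def)
  next
    case 3
    then have "1 \<le> i" "i \<le> j - 1" "j - 1 \<le> j" "1 \<le> j - 1" "j - 1 \<le> \<Gamma>"
      using i j by auto
    then have "z ! (j - 1) \<le> z ! i" "z ! j \<le> z ! (j - 1)"
      using decr j(2) by blast+
    then show ?thesis
      using ext 3 i by (auto simp: max_def min_def)
  qed
qed

lemma le_extend_cost:
  assumes "ranked \<Gamma> z" and "0 \<le> a"
  shows "z \<preceq> extend_cost \<Gamma> z a d"
proof (rule list_all2_all_nthI)
  show "length z = length (extend_cost \<Gamma> z a d)"
    using assms by (simp add: ranked_def length_extend_cost)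
next
  fix j assume "j < length z"
  then show "z ! j \<le> extend_cost \<Gamma> z a d ! j"
    using assms extend_cost_nth_0[of \<Gamma> z a d] extend_cost_nth[of \<Gamma> z j a d]
    by (cases "j = 0") (auto simp: ranked_def)
qed

lemma extend_cost_mono:
  assumes "ranked \<Gamma> z" and "ranked \<Gamma> w" and le: "z \<preceq> w"
  shows "extend_cost \<Gamma> z a d \<preceq> extend_cost \<Gamma> w a d"
proof (rule list_all2_all_nthI)
  fix j assume "j < length (extend_cost \<Gamma> z a d)"
  then have j: "j \<le> \<Gamma>"
    by (simp add: length_extend_cost)
  have le_nth: "z ! k \<le> w ! k" if "k \<le> \<Gamma>" for k
    using list_all2_nthD[OF le] assms(1) that by (simp add: ranked_def)
  show "extend_cost \<Gamma> z a d ! j \<le> extend_cost \<Gamma> w a d ! j"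
  proof (cases "j = 0")
    case True
    then show ?thesis
      using le_nth[of 0] by (simp add: extend_cost_nth_0)
  next
    case False
    then show ?thesis
      using extend_cost_nth[OF assms(1), of j a d] extend_cost_nth[OF assms(2), of j a d]
        max.mono[OF le_nth[of j] min.mono[OF order_refl[of d] le_nth[of "j - 1"]]]
        max.mono[OF le_nth[of j] order_refl[of d]] j
      by auto
  qed
qed (simp add: length_extend_cost)

section \<open>Extension computes the objective values\<close>

definition desc_values :: "('e \<Rightarrow> real) \<Rightarrow> 'e set \<Rightarrow> real list" where
  "desc_values \<delta> q = rev (sorted_list_of_multiset (image_mset \<delta> (mset_set q)))"

definition nth_or_0 :: "real list \<Rightarrow> nat \<Rightarrow> real" where
  "nth_or_0 ys k = (if k < length ys then ys ! k else 0)"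

lemma nth_or_0_simps:
  "nth_or_0 [] k = 0"
  "nth_or_0 (y # ys) 0 = y"
  "nth_or_0 (y # ys) (Suc k) = nth_or_0 ys k"
  by (simp_all add: nth_or_0_def)

lemma j_max_eq_nth_or_0: "1 \<le> j \<Longrightarrow> j_max j \<delta> q = nth_or_0 (desc_values \<delta> q) (j - 1)"
  by (auto simp: j_max_def nth_or_0_def desc_values_def Let_def)

lemma nth_or_0_antimono:
  assumes "sorted_wrt (\<ge>) ys" and "\<forall>y\<in>set ys. 0 \<le> y" and "k \<le> l"
  shows "nth_or_0 ys l \<le> nth_or_0 ys k"
  using assms sorted_wrt_nth_less[of "(\<ge>)" ys k l]
  by (cases "k = l") (auto simp: nth_or_0_def)

text \<open>Inserting \<open>d\<close> into a decreasing list with \<open>insort_key uminus\<close> leaves the entries above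
  \<open>d\<close> in place and shifts the others by one.  Since all values are nonnegative, the default \<open>0\<close>
  beyond the end behaves like an entry of the list.\<close>

lemma nth_or_0_insort_desc:
  assumes "sorted_wrt (\<ge>) ys" and "\<forall>y\<in>set ys. 0 \<le> y" and "0 \<le> d"
  shows "nth_or_0 (insort_key uminus d ys) k =
    max (nth_or_0 ys k) (if k = 0 then d else min d (nth_or_0 ys (k - 1)))"
  using assms
proof (induction ys arbitrary: k)
  case Nil
  then show ?case
    by (cases k) (auto simp: nth_or_0_simps)
next
  case (Cons y ys)
  show ?case
  proof (cases k)
    case 0
    then show ?thesis
      by (auto simp: nth_or_0_simps)
  next
    case (Suc k')
    have le_y: "nth_or_0 (y # ys) k' \<le> y"
      using nth_or_0_antimono[OF Cons.prems(1,2), of 0 k'] by (simp add: nth_or_0_simps)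
    have shift: "nth_or_0 ys k' \<le> nth_or_0 (y # ys) k'"
      using nth_or_0_antimono[OF Cons.prems(1,2), of k' "Suc k'"] by (simp add: nth_or_0_simps)
    show ?thesis
    proof (cases "y \<le> d")
      case True
      then show ?thesis
        using Suc le_y shift by (auto simp: nth_or_0_simps)
    next
      case False
      then show ?thesis
        using Suc Cons by (cases k') (auto simp: nth_or_0_simps)
    qed
  qed
qed

lemma desc_values_sorted: "sorted_wrt (\<ge>) (desc_values \<delta> q)"
  by (simp add: desc_values_def sorted_wrt_rev)

lemma set_desc_values: "finite q \<Longrightarrow> set (desc_values \<delta> q) = \<delta> ` q"
  by (simp add: desc_values_def)

lemma rev_insort:
  fixes x :: real
  assumes "sorted xs"
  shows "rev (insort x xs) = insort_key uminus x (rev xs)"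
proof -
  have "sorted (map uminus (rev xs))"
    using assms by (simp add: sorted_map sorted_wrt_rev)
  then have "sorted (map uminus (insort_key uminus x (rev xs)))"
    by (simp only: sorted_insort_key)
  then have "sorted (rev (insort_key uminus x (rev xs)))"
    unfolding sorted_map sorted_wrt_rev by simp
  then have "sort (insort x xs) = rev (insort_key uminus x (rev xs))"
    by (intro properties_for_sort) simp_all
  moreover have "sort (insort x xs) = insort x xs"
    using assms by (simp add: sorted_sort_id sorted_insort)
  ultimately show ?thesis
    by simp
qed

lemma desc_values_insert:
  "finite q \<Longrightarrow> e \<notin> q \<Longrightarrow> desc_values \<delta> (insert e q) = insort_key uminus (\<delta> e) (desc_values \<delta> q)"
  by (simp add: desc_values_def rev_insort)

text \<open>The recursion agrees with the closed form of \<open>\<oplus>\<close> entry by entry, which is why \<open>\<oplus>\<close> can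
  work with the \<open>\<Gamma>\<close> largest lengths alone: they determine those of the larger set.\<close>

lemma j_max_insert:
  assumes "finite q" and "e \<notin> q" and "\<forall>e'\<in>insert e q. 0 \<le> \<delta> e'" and "1 \<le> j"
  shows "j_max j \<delta> (insert e q) =
    max (j_max j \<delta> q) (if j = 1 then \<delta> e else min (\<delta> e) (j_max (j - 1) \<delta> q))"
proof -
  have "nth_or_0 (desc_values \<delta> (insert e q)) (j - 1) =
      max (nth_or_0 (desc_values \<delta> q) (j - 1))
        (if j - 1 = 0 then \<delta> e else min (\<delta> e) (nth_or_0 (desc_values \<delta> q) (j - 1 - 1)))"
    unfolding desc_values_insert[OF assms(1,2)]
    using assms by (intro nth_or_0_insort_desc desc_values_sorted) (auto simp: set_desc_values)
  then show ?thesis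
    using assms(4) by (cases "j = 1") (auto simp: j_max_eq_nth_or_0)
qed

lemma length_zL: "length (zL c \<delta> \<Gamma> q) = Suc \<Gamma>"
  by (simp add: zL_def)

lemma zL_nth: "1 \<le> j \<Longrightarrow> j \<le> \<Gamma> \<Longrightarrow> zL c \<delta> \<Gamma> q ! j = j_max j \<delta> q"
  by (cases j) (simp_all add: zL_def del: upt_Suc)

lemma zL_empty: "zL c \<delta> \<Gamma> {} = replicate (Suc \<Gamma>) 0"
proof (rule nth_equalityI)
  fix j assume "j < length (zL c \<delta> \<Gamma> {})"
  then show "zL c \<delta> \<Gamma> {} ! j = replicate (Suc \<Gamma>) 0 ! j"
    by (cases "j = 0")
      (auto simp: length_zL zL_nth j_max_eq_nth_or_0 desc_values_def nth_or_0_simps nth_Cons',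
       simp add: zL_def)
qed (simp add: length_zL)

lemma ranked_zL:
  assumes "finite q" and "\<forall>e\<in>q. 0 \<le> \<delta> e"
  shows "ranked \<Gamma> (zL c \<delta> \<Gamma> q)"
  using assms
  by (auto simp: ranked_def length_zL zL_nth j_max_eq_nth_or_0 set_desc_values
      intro!: nth_or_0_antimono desc_values_sorted)

lemma zL_insert:
  assumes "finite q" and "e \<notin> q" and "\<forall>e'\<in>insert e q. 0 \<le> \<delta> e'"
  shows "zL c \<delta> \<Gamma> (insert e q) = extend_cost \<Gamma> (zL c \<delta> \<Gamma> q) (c e) (\<delta> e)"
proof (rule nth_equalityI)
  have ranked: "ranked \<Gamma> (zL c \<delta> \<Gamma> q)"
    using assms by (intro ranked_zL) auto
  fix j assume "j < length (zL c \<delta> \<Gamma> (insert e q))"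
  then have "j \<le> \<Gamma>"
    by (simp add: length_zL)
  then show "zL c \<delta> \<Gamma> (insert e q) ! j = extend_cost \<Gamma> (zL c \<delta> \<Gamma> q) (c e) (\<delta> e) ! j"
  proof (cases "j = 0")
    case True
    then show ?thesis
      using assms by (simp add: extend_cost_nth_0 zL_def)
  next
    case False
    then show ?thesis
      using \<open>j \<le> \<Gamma>\<close> assms by (auto simp: extend_cost_nth[OF ranked] zL_nth j_max_insert)
  qed
qed (simp add: length_zL length_extend_cost)

section \<open>Covering by labels\<close>

definition covered :: "'a label set \<Rightarrow> 'a \<Rightarrow> cost_vec \<Rightarrow> bool" where
  "covered L v z \<longleftrightarrow> (\<exists>m\<in>L. label_node m = v \<and> label_cost m \<preceq> z)"

definition extension ::
  "('a \<times> 'a \<Rightarrow> real) \<Rightarrow> ('a \<times> 'a \<Rightarrow> real) \<Rightarrow> nat \<Rightarrow> 'a label \<Rightarrow> 'a \<times> 'a \<Rightarrow> 'a label" where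
  "extension c \<delta> \<Gamma> l e = Label (snd e) (extend_cost \<Gamma> (label_cost l) (c e) (\<delta> e)) (fst e) l"

lemma extension_simps:
  "label_node (extension c \<delta> \<Gamma> l e) = snd e"
  "label_cost (extension c \<delta> \<Gamma> l e) = extend_cost \<Gamma> (label_cost l) (c e) (\<delta> e)"
  "label_path (extension c \<delta> \<Gamma> l e) = label_path l @ [e]"
  by (simp_all add: extension_def)

lemma process_edge_eq:
  "process_edge c \<delta> \<Gamma> l' P e T =
    (let l = extension c \<delta> \<Gamma> l' e
     in if covered (T \<union> P) (label_node l) (label_cost l) then T
        else insert l {m\<in>T. \<not> (label_node m = label_node l \<and> dominates (label_cost l) (label_cost m))})"
  unfolding process_edge_def covered_def dominates_or_eq_iff Let_def extension_def by auto

text \<open>A label that is deleted leaves behind the new label, which dominates it.\<close>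

lemma covered_process_edge:
  assumes "covered (T \<union> P) v z"
  shows "covered (process_edge c \<delta> \<Gamma> l' P e T \<union> P) v z"
proof -
  define l where "l = extension c \<delta> \<Gamma> l' e"
  show ?thesis
  proof (cases "covered (T \<union> P) (label_node l) (label_cost l)")
    case True
    then show ?thesis
      using assms by (simp add: process_edge_eq l_def Let_def)
  next
    case False
    obtain m where m: "m \<in> T \<union> P" "label_node m = v" "label_cost m \<preceq> z"
      using assms by (auto simp: covered_def)
    show ?thesis
    proof (cases "label_node m = label_node l \<and> dominates (label_cost l) (label_cost m)")
      case True
      then have "label_cost l \<preceq> z"
        using m(3) le_vec_trans by (auto simp: dominates_def)
      then show ?thesis
        using True False m(2) by (auto simp: process_edge_eq l_def[symmetric] Let_def covered_def)
    next
      case keep: False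
      then show ?thesis
        using False m by (auto simp: process_edge_eq l_def[symmetric] Let_def covered_def)
    qed
  qed
qed

lemma covered_fold_process_edge:
  "covered (T \<union> P) v z \<Longrightarrow> covered (fold (process_edge c \<delta> \<Gamma> l' P) es T \<union> P) v z"
  by (induction es arbitrary: T) (auto intro: covered_process_edge)

lemma process_edge_covers_extension:
  "covered (process_edge c \<delta> \<Gamma> l' P e T \<union> P) (snd e) (extend_cost \<Gamma> (label_cost l') (c e) (\<delta> e))"
  by (auto simp: process_edge_eq Let_def extension_simps covered_def le_vec_refl)

lemma fold_process_edge_covers_extensions:
  assumes "e \<in> set es"
  shows "covered (fold (process_edge c \<delta> \<Gamma> l' P) es T \<union> P)
    (snd e) (extend_cost \<Gamma> (label_cost l') (c e) (\<delta> e))"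
  using assms
proof (induction es arbitrary: T)
  case (Cons e' es)
  then show ?case
    by (cases "e = e'") (auto intro: covered_fold_process_edge process_edge_covers_extension)
qed simp

section \<open>Invariants of the algorithm\<close>

locale label_setting = pair_fin_digraph G
  for G :: "'a pair_pre_digraph" +
  fixes c \<delta> :: "'a \<times> 'a \<Rightarrow> real" and \<Gamma> :: nat and s :: 'a
  assumes source: "s \<in> pverts G"
    and cost_nonneg: "e \<in> parcs G \<Longrightarrow> 0 \<le> c e"
    and length_nonneg: "e \<in> parcs G \<Longrightarrow> 0 \<le> \<delta> e"
begin

text \<open>Requiring the predecessor to be permanent makes all ancestors of a label permanent, once
  every permanent label is sound.\<close>

definition sound :: "'a label set \<Rightarrow> 'a label \<Rightarrow> bool" where
  "sound P l \<longleftrightarrow> apath s (label_path l) (label_node l) \<and>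
     label_cost l = zL c \<delta> \<Gamma> (set (label_path l)) \<and>
     (\<forall>v z v' l'. l = Label v z v' l' \<longrightarrow> l' \<in> P)"

definition undominated :: "'a label set \<Rightarrow> bool" where
  "undominated L \<longleftrightarrow>
     (\<forall>l\<in>L. \<forall>m\<in>L. label_node l = label_node m \<longrightarrow> \<not> dominates (label_cost l) (label_cost m))"

definition inv :: "'a label set \<Rightarrow> 'a label set \<Rightarrow> bool" where
  "inv P T \<longleftrightarrow> (\<forall>l\<in>T \<union> P. sound P l) \<and> undominated (T \<union> P) \<and>
     (\<forall>p\<in>P. \<forall>m\<in>T. sum_list (label_cost p) \<le> sum_list (label_cost m))"

lemma apath_arcs: "apath u p v \<Longrightarrow> set p \<subseteq> parcs G"
  by (auto simp: apath_def awalk_def)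

lemma ranked_zL_apath: "apath u p v \<Longrightarrow> ranked \<Gamma> (zL c \<delta> \<Gamma> (set p))"
  using apath_arcs length_nonneg by (intro ranked_zL) blast+

lemma apath_snoc_iff:
  "apath u (p @ [e]) v \<longleftrightarrow>
     apath u p (fst e) \<and> e \<in> parcs G \<and> snd e = v \<and> v \<notin> set (awalk_verts u p)"
proof -
  have "awlast u p = fst e" if "apath u p (fst e)"
    using that awlast_of_awalk by (auto simp: apath_def)
  moreover from this have "fst e \<in> set (awalk_verts u p)" if "apath u p (fst e)"
    using that last_in_set[of "awalk_verts u p"] awalk_verts_non_Nil[of u p] by simp
  ultimately show ?thesis
    using arc_snd_in_verts[of e] arc_fst_in_verts[of e]
    by (auto simp: apath_append_iff apath_Cons_iff apath_Nil_iff)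
qed

lemma apath_snocD:
  assumes "apath u (p @ [e]) v"
  shows "apath u p (fst e)" and "e \<in> parcs G" and "snd e = v"
  using assms by (auto simp: apath_snoc_iff)

text \<open>Objective values are attached to edge sets, so the step needs a new edge; a path without
  repeated nodes provides it.\<close>

lemma zL_apath_snoc:
  assumes "apath u (p @ [e]) v"
  shows "zL c \<delta> \<Gamma> (set (p @ [e])) = extend_cost \<Gamma> (zL c \<delta> \<Gamma> (set p)) (c e) (\<delta> e)"
proof -
  have "distinct (p @ [e])"
    using assms distinct_verts_imp_distinct[of u "p @ [e]" v] by (simp add: apath_def)
  then have "zL c \<delta> \<Gamma> (insert e (set p)) = extend_cost \<Gamma> (zL c \<delta> \<Gamma> (set p)) (c e) (\<delta> e)"
    using apath_arcs[OF assms] length_nonneg by (intro zL_insert) auto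
  then show ?thesis
    by simp
qed

lemma soundD:
  assumes "sound P l"
  shows "apath s (label_path l) (label_node l)"
    and "label_cost l = zL c \<delta> \<Gamma> (set (label_path l))"
    and "ranked \<Gamma> (label_cost l)"
  using assms ranked_zL_apath by (auto simp: sound_def)

text \<open>The nodes on the path of a permanent label carry its ancestors, whose costs only grow
  towards the label.\<close>

lemma ancestors_cover_path:
  assumes "\<forall>p\<in>P. sound P p" and "l \<in> P" and "u \<in> set (awalk_verts s (label_path l))"
  shows "covered P u (label_cost l)"
  using assms(2,3)
proof (induction l)
  case (Start_Label v z)
  then have "apath s [] v"
    using assms(1) soundD(1) by fastforce
  then show ?case
    using Start_Label by (auto simp: covered_def apath_Nil_iff le_vec_refl intro!: bexI[of _ "Start_Label v z"])
next
  case (Label v z v' l')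
  let ?l = "Label v z v' l'"
  have l: "sound P ?l" and l': "l' \<in> P" "sound P l'"
    using assms(1) Label.prems(1) unfolding sound_def by blast+
  have path: "apath s (label_path l' @ [(v', v)]) v"
    using soundD(1)[OF l] by simp
  have "z = extend_cost \<Gamma> (label_cost l') (c (v', v)) (\<delta> (v', v))"
    using zL_apath_snoc[OF path] soundD(2)[OF l] soundD(2)[OF l'(2)] by simp
  then have grow: "label_cost l' \<preceq> z"
    using le_extend_cost soundD(3)[OF l'(2)] cost_nonneg apath_snocD(2)[OF path] by simp
  have "u = v \<or> u \<in> set (awalk_verts s (label_path l'))"
    using Label.prems(2) apath_snocD(1)[OF path]
    by (auto simp: awalk_verts_conv apath_def awalk_conv split: if_splits)
  then show ?case
  proof
    assume "u = v"
    then show ?thesis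
      using Label.prems(1) by (auto simp: covered_def le_vec_refl intro!: bexI[of _ ?l])
  next
    assume "u \<in> set (awalk_verts s (label_path l'))"
    then have "covered P u (label_cost l')"
      using Label.IH l'(1) by simp
    then show ?thesis
      using grow le_vec_trans by (auto simp: covered_def)
  qed
qed

lemma sound_extension:
  assumes sound: "\<forall>p\<in>P. sound P p" and l': "l' \<in> P"
    and e: "e \<in> out_arcs G (label_node l')"
    and new: "\<not> covered P (snd e) (extend_cost \<Gamma> (label_cost l') (c e) (\<delta> e))"
  shows "sound P (extension c \<delta> \<Gamma> l' e)"
proof -
  have l'_sound: "sound P l'"
    using sound l' by simp
  have arc: "e \<in> parcs G" "fst e = label_node l'"
    using e by auto
  \<comment> \<open>otherwise the edge closes a cycle, and an ancestor covers the new label\<close>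
  have "snd e \<notin> set (awalk_verts s (label_path l'))"
  proof
    assume "snd e \<in> set (awalk_verts s (label_path l'))"
    then have "covered P (snd e) (label_cost l')"
      using ancestors_cover_path[OF sound l'] by simp
    moreover have "label_cost l' \<preceq> extend_cost \<Gamma> (label_cost l') (c e) (\<delta> e)"
      using le_extend_cost soundD(3)[OF l'_sound] cost_nonneg arc(1) by simp
    ultimately show False
      using new le_vec_trans by (auto simp: covered_def)
  qed
  then have path: "apath s (label_path l' @ [e]) (snd e)"
    using soundD(1)[OF l'_sound] arc
    by (simp add: apath_snoc_iff)
  then show ?thesis
    using zL_apath_snoc[OF path] soundD(2)[OF l'_sound] l'
    by (auto simp: sound_def extension_def prod_eq_iff)
qed

text \<open>The new label cannot dominate a permanent label, because that would give it a smaller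
  aggregate cost; dominated temporary labels are deleted.\<close>

lemma inv_process_edge:
  assumes inv: "inv P T" and l': "l' \<in> P"
    and max: "\<forall>p\<in>P. sum_list (label_cost p) \<le> sum_list (label_cost l')"
    and e: "e \<in> out_arcs G (label_node l')"
  shows "inv P (process_edge c \<delta> \<Gamma> l' P e T)"
proof -
  define l where "l = extension c \<delta> \<Gamma> l' e"
  show ?thesis
  proof (cases "covered (T \<union> P) (label_node l) (label_cost l)")
    case True
    then show ?thesis
      using inv by (simp add: process_edge_eq l_def Let_def)
  next
    case False
    let ?T = "insert l {m\<in>T. \<not> (label_node m = label_node l \<and> dominates (label_cost l) (label_cost m))}"
    have sound: "\<forall>m\<in>T \<union> P. sound P m"
      using inv by (simp add: inv_def)
    have "sound P l"
      unfolding l_def using sound l' e False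
      by (intro sound_extension) (auto simp: covered_def l_def extension_simps)
    moreover have "label_cost l' \<preceq> label_cost l"
      unfolding l_def extension_simps
      using sound l' e by (intro le_extend_cost soundD(3)[of P] cost_nonneg) auto
    then have sums: "\<forall>p\<in>P. sum_list (label_cost p) \<le> sum_list (label_cost l)"
      using max sum_list_le_vec by fastforce
    moreover have "undominated (?T \<union> P)"
    proof -
      have "\<not> dominates (label_cost l) (label_cost p)" if "p \<in> P" for p
        using sums that sum_list_less_if_dominates by fastforce
      moreover have "\<not> dominates (label_cost m) (label_cost l)"
        if "m \<in> T \<union> P" "label_node m = label_node l" for m
        using False that by (auto simp: covered_def dominates_def)
      moreover have "undominated (T \<union> P)"
        using inv by (simp add: inv_def)
      ultimately show ?thesis
        unfolding undominated_def by (auto simp: dominates_def[of "label_cost l" "label_cost l"])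
    qed
    ultimately have "inv P ?T"
      using inv by (auto simp: inv_def)
    then show ?thesis
      using False by (simp add: process_edge_eq l_def Let_def)
  qed
qed

lemma inv_fold_process_edge:
  assumes "inv P T" and "l' \<in> P"
    and "\<forall>p\<in>P. sum_list (label_cost p) \<le> sum_list (label_cost l')"
    and "set es \<subseteq> out_arcs G (label_node l')"
  shows "inv P (fold (process_edge c \<delta> \<Gamma> l' P) es T)"
  using assms
proof (induction es arbitrary: T)
  case (Cons e es)
  then show ?case
    using inv_process_edge[of P T l' e] by simp
qed simp

definition covering :: "'a label set \<Rightarrow> 'a label set \<Rightarrow> bool" where
  "covering P T \<longleftrightarrow> covered (T \<union> P) s (zL c \<delta> \<Gamma> {}) \<and>
     (\<forall>p\<in>P. \<forall>e\<in>out_arcs G (label_node p).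
        covered (T \<union> P) (snd e) (extend_cost \<Gamma> (label_cost p) (c e) (\<delta> e)))"

lemma inv_initial: "inv {} {Start_Label s (replicate (Suc \<Gamma>) 0)}"
  using source
  by (simp add: inv_def sound_def undominated_def dominates_def zL_empty apath_Nil_iff
      del: replicate_Suc)

lemma covering_initial: "covering {} {Start_Label s (replicate (Suc \<Gamma>) 0)}"
  by (simp add: covering_def covered_def zL_empty le_vec_refl del: replicate_Suc)

text \<open>Making the selected label permanent only moves it between the two sets.  Its minimal
  aggregate cost keeps the permanent labels below the temporary ones, and processing all its
  outgoing edges covers its extensions.\<close>

lemma label_step_preserves:
  assumes "label_step G c \<delta> \<Gamma> (T, P) (T', P')" and inv: "inv P T" and cov: "covering P T"
  shows "inv P' T' \<and> covering P' T'"
  using assms(1)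
proof cases
  case (1 l' es)
  have union: "T - {l'} \<union> P' = T \<union> P"
    using 1 by auto
  have "inv P' (T - {l'})"
    unfolding inv_def union using inv 1 by (auto simp: inv_def sound_def)
  moreover have "\<forall>p\<in>P'. sum_list (label_cost p) \<le> sum_list (label_cost l')"
    using inv 1 by (auto simp: inv_def)
  ultimately have "inv P' T'"
    using 1 inv_fold_process_edge[of P' "T - {l'}" l' es] by auto
  moreover have keep: "covered (T' \<union> P') v z" if "covered (T \<union> P) v z" for v z
    using covered_fold_process_edge[of "T - {l'}" P' v z] that union 1 by simp
  have "covering P' T'"
    unfolding covering_def
  proof (intro conjI ballI)
    show "covered (T' \<union> P') s (zL c \<delta> \<Gamma> {})"
      using cov keep by (simp add: covering_def)
  next
    fix p e assume "p \<in> P'" and e: "e \<in> out_arcs G (label_node p)"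
    then consider "p = l'" | "p \<in> P"
      using 1 by auto
    then show "covered (T' \<union> P') (snd e) (extend_cost \<Gamma> (label_cost p) (c e) (\<delta> e))"
    proof cases
      case new: 1
      then show ?thesis
        using 1 e fold_process_edge_covers_extensions[of e es c \<delta> \<Gamma> l' P' "T - {l'}"] by simp
    next
      case 2
      then show ?thesis
        using cov keep e by (simp add: covering_def)
    qed
  qed
  ultimately show ?thesis
    by simp
qed

lemma stops_with_invariants:
  assumes "stops_with G c \<delta> \<Gamma> s P"
  shows "inv P {}" and "covering P {}"
proof -
  have "inv (snd S) (fst S) \<and> covering (snd S) (fst S)"
    if "(label_step G c \<delta> \<Gamma>)\<^sup>*\<^sup>* (initial_state \<Gamma> s) S" for S
    using that
  proof (induction rule: rtranclp_induct)
    case base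
    then show ?case
      using inv_initial covering_initial by (simp add: initial_state_def)
  next
    case (step S S')
    then show ?case
      using label_step_preserves[of "fst S" "snd S" "fst S'" "snd S'"] by simp
  qed
  then show "inv P {}" and "covering P {}"
    using assms by (fastforce simp: stops_with_def)+
qed

section \<open>Completeness of the permanent labels\<close>

text \<open>By Bellman's principle the label covering a prefix extends to a vector that is no worse than
  the cost of the path, and that vector is covered in turn.\<close>

lemma permanent_labels_cover_paths:
  assumes inv: "inv P {}" and cov: "covering P {}" and "apath s p v"
  shows "covered P v (zL c \<delta> \<Gamma> (set p))"
  using assms(3)
proof (induction p arbitrary: v rule: rev_induct)
  case Nil
  then have "v = s"
    by (simp add: apath_Nil_iff)
  then show ?case
    using cov by (simp add: covering_def)
next
  case (snoc e p)
  note path = apath_snocD[OF snoc.prems]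
  obtain m where m: "m \<in> P" "label_node m = fst e" "label_cost m \<preceq> zL c \<delta> \<Gamma> (set p)"
    using snoc.IH[OF path(1)] by (auto simp: covered_def)
  have "sound P m"
    using inv m(1) by (simp add: inv_def)
  then have "extend_cost \<Gamma> (label_cost m) (c e) (\<delta> e) \<preceq> zL c \<delta> \<Gamma> (set (p @ [e]))"
    unfolding zL_apath_snoc[OF snoc.prems]
    using extend_cost_mono soundD(3) ranked_zL_apath[OF path(1)] m(3) by blast
  moreover have "covered P v (extend_cost \<Gamma> (label_cost m) (c e) (\<delta> e))"
    using cov m(1,2) path(2,3) by (auto simp: covering_def)
  ultimately show ?case
    using le_vec_trans by (auto simp: covered_def)
qed

text \<open>A path dominating a represented one is itself covered by a permanent label, which would
  dominate the label of the represented path.  Hence represented paths are efficient, and an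
  equal cost vector in the covering label gives equivalence.\<close>

lemma represented_paths_complete:
  assumes inv: "inv P {}" and cov: "covering P {}"
  shows "complete_efficient_set (zL c \<delta> \<Gamma>) (st_paths G s t) (represented_paths P t)"
proof -
  let ?z = "zL c \<delta> \<Gamma>" and ?Q = "st_paths G s t" and ?R = "represented_paths P t"
  have sound: "sound P l" if "l \<in> P" for l
    using inv that by (simp add: inv_def)
  have covers: "\<exists>l\<in>P. label_node l = t \<and> label_cost l \<preceq> ?z q" if "q \<in> ?Q" for q
    using that permanent_labels_cover_paths[OF inv cov] by (auto simp: st_paths_def covered_def)
  have subset: "?R \<subseteq> ?Q"
    using sound soundD(1) by (fastforce simp: represented_paths_def st_paths_def)
  have eff: "efficient ?z ?Q r" if r: "r \<in> ?R" for r
  proof -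
    obtain l where l: "l \<in> P" "label_node l = t" "r = set (label_path l)"
      using r by (auto simp: represented_paths_def)
    have cost: "label_cost l = ?z r"
      using soundD(2)[OF sound[OF l(1)]] l(3) by simp
    have "\<not> dominates (?z q) (?z r)" if "q \<in> ?Q" for q
    proof
      assume "dominates (?z q) (?z r)"
      moreover obtain m where m: "m \<in> P" "label_node m = t" "label_cost m \<preceq> ?z q"
        using covers[OF \<open>q \<in> ?Q\<close>] by blast
      ultimately have "dominates (label_cost m) (label_cost l)"
        using dominates_le_trans cost by simp
      then show False
        using inv l m by (auto simp: inv_def undominated_def)
    qed
    then show ?thesis
      using r subset by (auto simp: efficient_def)
  qed
  have "\<exists>r\<in>?R. dominates (?z r) (?z q) \<or> equivalent_solutions ?z ?Q r q" if q: "q \<in> ?Q" for q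
  proof -
    obtain l where l: "l \<in> P" "label_node l = t" "label_cost l \<preceq> ?z q"
      using covers[OF q] by blast
    let ?r = "set (label_path l)"
    have r: "?r \<in> ?R"
      using l by (auto simp: represented_paths_def)
    have "dominates (?z ?r) (?z q) \<or> ?z ?r = ?z q"
      using l soundD(2)[OF sound] by (simp add: dominates_or_eq_iff)
    then show ?thesis
      using r eff[OF r] q by (auto simp: equivalent_solutions_def efficient_def)
  qed
  then show ?thesis
    using subset eff by (auto simp: complete_efficient_set_def)
qed

end

theorem theorem33:
  fixes G :: "'a pair_pre_digraph"
    and s t :: 'a
    and c \<delta> :: "'a \<times> 'a \<Rightarrow> real"
    and \<Gamma> :: nat
    and P :: "'a label set"
  assumes "pair_fin_digraph G"
    and "s \<in> pverts G" and "t \<in> pverts G"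
    and "\<And>e. e \<in> parcs G \<Longrightarrow> 0 \<le> c e"
    and "\<And>e. e \<in> parcs G \<Longrightarrow> 0 \<le> \<delta> e"
    and "\<Gamma> \<le> card (parcs G)"
    and "stops_with G c \<delta> \<Gamma> s P"
  shows "complete_efficient_set (zL c \<delta> \<Gamma>) (st_paths G s t) (represented_paths P t)"
proof -
  interpret pair_fin_digraph G
    by fact
  interpret label_setting G c \<delta> \<Gamma> s
    using assms by unfold_locales auto
  show ?thesis
    using stops_with_invariants[OF assms(7)] represented_paths_complete by blast
qed

end
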